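(* Let $L\in\mathcal E_\infty$. (1) The map $F_L:\mathcal C_\infty\to\mathcal O_\infty$, $\alpha\mapsto F_L(\alpha)$, is a linear map of $\mathcal O_\infty$-modules. Moreover, if $L(1)(z)\ne0$ for all $z$ with $\operatorname{Re} z\gg0$, then $F_L$ is surjective. (2) If $L(ab)=L(a)L(b)$ for all $a,b\in\mathbb N$ and $L\ne0$, then $F_L$ is a surjective morphism of $\mathcal O_\infty$-algebras with $F_L(f\cdot e)=f$ for all $f\in\mathcal O_\infty$.
   Context: $\mathbb N=\{1,2,\dots\}$. For a commutative ring $R$, $\Omega(\mathbb N,R)$ is the set of maps $\mathbb N\to R$, an $R$-algebra under pointwise addition, Dirichlet convolution $(\alpha\cdot\beta)(n)=\sum_{ab=n}\alpha(a)\beta(b)$ and $(f\alpha)(n)=f\alpha(n)$; $e$ denotes the unit, $e(1)=1$, $e(n)=0$ for $n\ge2$. For $k\in\mathbb R$, $\mathcal O_k$ is the ring of holomorphic functions on $\{\operatorname{Re} z>k\}$; $\mathcal O_\infty=\bigcup_k\mathcal O_k$ is the direct limit under the injective restriction maps (functions holomorphic on some right half-plane, identified when they agree on a common right half-plane). $\mathcal C_k$ is the set of $\alpha\in\Omega(\mathbb N,\mathcal O_k)$ such that for every $\varepsilon>0$ there is a continuous $M_\varepsilon:\{\operatorname{Re} z>k\}\to[0,\infty)$ with $|\alpha(n)(z)|<n^{k+\varepsilon}M_\varepsilon(z)$ for all $n\ge1$, $\operatorname{Re} z>k$; $\mathcal C_\infty=\bigcup_k\mathcal C_k$. $\mathcal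 E_k$ is the set of $L\in\Omega(\mathbb N,\mathcal O_k)$ for which there are a constant $c>0$ and a continuous $C:\{\operatorname{Re} z>k\}\to[0,\infty)$ with $|L(n)(z)|\le C(z)n^{-c\operatorname{Re} z}$ for all $n\ge1$, $\operatorname{Re} z>k$; $\mathcal E_\infty=\bigcup_k\mathcal E_k$. For $L\in\mathcal E_\infty$, $\alpha\in\mathcal C_\infty$, $F_L(\alpha)(z)=\sum_{n\ge1}\alpha(n)(z)L(n)(z)$, which converges absolutely and locally uniformly on some right half-plane and is regarded as an element of $\mathcal O_\infty$. *)

theory Defs
  imports "HOL-Complex_Analysis.Complex_Analysis"
begin

definition half_plane :: "real \<Rightarrow> complex set" where
  "half_plane k = {z. Re z > k}"

lemma open_half_plane: "open (half_plane k)"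
  unfolding half_plane_def by (rule open_halfspace_Re_gt)

lemma connected_half_plane: "connected (half_plane k)"
  unfolding half_plane_def by (intro convex_connected convex_halfspace_Re_gt)

lemma half_plane_nonempty: "half_plane k \<noteq> {}"
proof -
  have "complex_of_real (k + 1) \<in> half_plane k" by (simp add: half_plane_def)
  then show ?thesis by blast
qed

lemma half_plane_mono: "k \<le> l \<Longrightarrow> half_plane l \<subseteq> half_plane k"
  by (auto simp: half_plane_def)

definition germ_rel :: "(complex \<Rightarrow> complex) \<Rightarrow> (complex \<Rightarrow> complex) \<Rightarrow> bool" where
  "germ_rel f g \<longleftrightarrow> (\<exists>k. f holomorphic_on half_plane k \<and> g holomorphic_on half_plane k \<and>
                          (\<forall>z\<in>half_plane k. f z = g z))"

lemma germ_relI: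
  assumes "f holomorphic_on half_plane k" "g holomorphic_on half_plane l"
    and "\<And>z. z \<in> half_plane m \<Longrightarrow> f z = g z"
  shows "germ_rel f g"
  unfolding germ_rel_def
proof (intro exI conjI ballI)
  let ?K = "max k (max l m)"
  show "f holomorphic_on half_plane ?K" "g holomorphic_on half_plane ?K"
    using assms(1,2) by (auto elim!: holomorphic_on_subset simp: half_plane_def)
  show "f z = g z" if "z \<in> half_plane ?K" for z
    using assms(3) that by (auto simp: half_plane_def)
qed

text \<open>The direct limit \<open>\<O>\<^sub>\<infinity>\<close>; \<open>germ f\<close> is meaningful for \<open>f\<close> holomorphic on some right half-plane.\<close>

quotient_type oinf = "complex \<Rightarrow> complex" / partial: germ_rel
  morphisms rep_oinf germ
proof (rule part_equivpI)
  show "\<exists>f. germ_rel f f"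
    by (rule exI[of _ "\<lambda>_. 0"]) (auto simp: germ_rel_def)
  show "symp germ_rel"
    by (auto intro!: sympI simp: germ_rel_def) metis
  show "transp germ_rel"
  proof (rule transpI)
    fix f g h assume "germ_rel f g" "germ_rel g h"
    then obtain k l where *: "f holomorphic_on half_plane k" "\<forall>z\<in>half_plane k. f z = g z"
      "h holomorphic_on half_plane l" "\<forall>z\<in>half_plane l. g z = h z"
      unfolding germ_rel_def by blast
    show "germ_rel f h"
      by (rule germ_relI[OF *(1,3), of "max k l"]) (use * in \<open>auto simp: half_plane_def\<close>)
  qed
qed

lemma germ_rel_refl_iff: "germ_rel f f \<longleftrightarrow> (\<exists>k. f holomorphic_on half_plane k)"
  by (auto simp: germ_rel_def)

lemma germ_eq_iff:
  assumes "f holomorphic_on half_plane k" "g holomorphic_on half_plane l"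
  shows "germ f = germ g \<longleftrightarrow> germ_rel f g"
  using Quotient3_rel[OF Quotient3_oinf, of f g] assms germ_rel_refl_iff by blast

lemma germ_cases:
  obtains f k where "f holomorphic_on half_plane k" "x = germ f"
proof -
  have "germ_rel (rep_oinf x) (rep_oinf x)" "germ (rep_oinf x) = x"
    using Quotient3_rep_reflp[OF Quotient3_oinf] Quotient3_abs_rep[OF Quotient3_oinf] by auto
  moreover from this obtain k where "rep_oinf x holomorphic_on half_plane k"
    unfolding germ_rel_refl_iff by blast
  ultimately show ?thesis by (intro that) auto
qed

lemma germ_rel_binop:
  assumes "\<And>S f g. f holomorphic_on S \<Longrightarrow> g holomorphic_on S \<Longrightarrow> (\<lambda>z. h (f z) (g z)) holomorphic_on S"
    and "germ_rel f f'" "germ_rel g g'"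
  shows "germ_rel (\<lambda>z. h (f z) (g z)) (\<lambda>z. h (f' z) (g' z))"
proof -
  obtain k l where *: "f holomorphic_on half_plane k" "f' holomorphic_on half_plane k"
    "\<forall>z\<in>half_plane k. f z = f' z"
    "g holomorphic_on half_plane l" "g' holomorphic_on half_plane l"
    "\<forall>z\<in>half_plane l. g z = g' z"
    using assms(2,3) unfolding germ_rel_def by blast
  have sub: "half_plane (max k l) \<subseteq> half_plane k" "half_plane (max k l) \<subseteq> half_plane l"
    by (auto simp: half_plane_def)
  show ?thesis
  proof (rule germ_relI[of _ "max k l" _ "max k l" "max k l"])
    show "(\<lambda>z. h (f z) (g z)) holomorphic_on half_plane (max k l)"
      by (rule assms(1)) (use * sub holomorphic_on_subset in blast)+
    show "(\<lambda>z. h (f' z) (g' z)) holomorphic_on half_plane (max k l)"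
      by (rule assms(1)) (use * sub holomorphic_on_subset in blast)+
    show "h (f z) (g z) = h (f' z) (g' z)" if "z \<in> half_plane (max k l)" for z
      using *(3,6) sub that by (metis subsetD)
  qed
qed

instantiation oinf :: comm_ring_1
begin

lift_definition zero_oinf :: oinf is "\<lambda>_. 0" by (auto simp: germ_rel_def)
lift_definition one_oinf :: oinf is "\<lambda>_. 1" by (auto simp: germ_rel_def)
lift_definition plus_oinf :: "oinf \<Rightarrow> oinf \<Rightarrow> oinf" is "\<lambda>f g z. f z + g z"
  by (rule germ_rel_binop) (auto intro: holomorphic_intros)
lift_definition minus_oinf :: "oinf \<Rightarrow> oinf \<Rightarrow> oinf" is "\<lambda>f g z. f z - g z"
  by (rule germ_rel_binop) (auto intro: holomorphic_intros)
lift_definition times_oinf :: "oinf \<Rightarrow> oinf \<Rightarrow> oinf" is "\<lambda>f g z. f z * g z"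
  by (rule germ_rel_binop) (auto intro: holomorphic_intros)
lift_definition uminus_oinf :: "oinf \<Rightarrow> oinf" is "\<lambda>f z. - f z"
proof -
  fix f g :: "complex \<Rightarrow> complex"
  assume "germ_rel f g"
  then show "germ_rel (\<lambda>z. - f z) (\<lambda>z. - g z)"
    using germ_rel_binop[of "\<lambda>a b. - a" f g f g] by (auto intro: holomorphic_intros)
qed

lemma plus_germ:
  "f holomorphic_on half_plane k \<Longrightarrow> g holomorphic_on half_plane l \<Longrightarrow>
     germ f + germ g = germ (\<lambda>z. f z + g z)"
  by (rule plus_oinf.abs_eq) (auto simp: eq_onp_def germ_rel_refl_iff)

lemma minus_germ:
  "f holomorphic_on half_plane k \<Longrightarrow> g holomorphic_on half_plane l \<Longrightarrow>
     germ f - germ g = germ (\<lambda>z. f z - g z)"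
  by (rule minus_oinf.abs_eq) (auto simp: eq_onp_def germ_rel_refl_iff)

lemma times_germ:
  "f holomorphic_on half_plane k \<Longrightarrow> g holomorphic_on half_plane l \<Longrightarrow>
     germ f * germ g = germ (\<lambda>z. f z * g z)"
  by (rule times_oinf.abs_eq) (auto simp: eq_onp_def germ_rel_refl_iff)

lemma uminus_germ:
  "f holomorphic_on half_plane k \<Longrightarrow> - germ f = germ (\<lambda>z. - f z)"
  by (rule uminus_oinf.abs_eq) (auto simp: eq_onp_def germ_rel_refl_iff)

lemma germ_rel_arith:
  "germ_rel (\<lambda>_. c) (\<lambda>_. c)"
  "germ_rel f f' \<Longrightarrow> germ_rel g g' \<Longrightarrow> germ_rel (\<lambda>z. f z + g z) (\<lambda>z. f' z + g' z)"
  "germ_rel f f' \<Longrightarrow> germ_rel g g' \<Longrightarrow> germ_rel (\<lambda>z. f z - g z) (\<lambda>z. f' z - g' z)"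
  "germ_rel f f' \<Longrightarrow> germ_rel g g' \<Longrightarrow> germ_rel (\<lambda>z. f z * g z) (\<lambda>z. f' z * g' z)"
proof -
  show "germ_rel (\<lambda>_. c) (\<lambda>_. c)" by (simp add: germ_rel_refl_iff)
qed (rule germ_rel_binop; auto intro: holomorphic_intros)+

instance
proof
  show "(0::oinf) \<noteq> 1"
  proof
    assume "(0::oinf) = 1"
    then obtain k :: real where "\<forall>z\<in>half_plane k. (0::complex) = 1"
      by transfer (auto simp: germ_rel_def)
    then show False using half_plane_nonempty[of k] by auto
  qed
qed (transfer; simp add: algebra_simps; ((assumption | rule germ_rel_arith)+)?)+

end

lifting_forget oinf.lifting

definition O_space :: "real \<Rightarrow> oinf set" where
  "O_space k = {germ f |f. f holomorphic_on half_plane k}"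

text \<open>The value at \<open>z\<close> of an element of \<open>\<O>\<^sub>\<infinity>\<close>, taken from any representative holomorphic on a right
  half-plane containing \<open>z\<close>; independence of the representative is the identity theorem.\<close>

definition germ_eval :: "oinf \<Rightarrow> complex \<Rightarrow> complex" where
  "germ_eval g z = (THE w. \<exists>k f. f holomorphic_on half_plane k \<and> germ f = g \<and>
                                   z \<in> half_plane k \<and> f z = w)"

lemma germ_eq_imp_eq_on:
  assumes "f holomorphic_on half_plane k" "g holomorphic_on half_plane l" "germ f = germ g"
    and "z \<in> half_plane k" "z \<in> half_plane l"
  shows "f z = g z"
proof -
  have "germ_rel f g" using assms germ_eq_iff by blast
  then obtain m where m: "\<forall>z\<in>half_plane m. f z = g z" by (auto simp: germ_rel_def)
  let ?K = "max k l" and ?N = "max m (max k l)"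
  show ?thesis
  proof (rule analytic_continuation_open[of "half_plane ?N" "half_plane ?K" f g])
    show "f holomorphic_on half_plane ?K" "g holomorphic_on half_plane ?K"
      using assms(1,2) by (auto elim!: holomorphic_on_subset simp: half_plane_def)
    show "z \<in> half_plane ?K" using assms(4,5) by (simp add: half_plane_def)
    show "f w = g w" if "w \<in> half_plane ?N" for w
      using m that by (auto simp: half_plane_def)
    show "half_plane ?N \<subseteq> half_plane ?K" by (rule half_plane_mono) simp
  qed (auto intro: open_half_plane connected_half_plane simp: half_plane_nonempty)
qed

lemma germ_eval_germ:
  assumes "f holomorphic_on half_plane k" "z \<in> half_plane k"
  shows "germ_eval (germ f) z = f z"
  unfolding germ_eval_def
proof (rule the_equality)
  show "\<exists>l g. g holomorphic_on half_plane l \<and> germ g = germ f \<and> z \<in> half_plane l \<and> g z = f z"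
    using assms by blast
  show "w = f z" if "\<exists>l g. g holomorphic_on half_plane l \<and> germ g = germ f \<and> z \<in> half_plane l \<and> g z = w" for w
    using that assms germ_eq_imp_eq_on by metis
qed

lemma O_space_mono: "k \<le> l \<Longrightarrow> O_space k \<subseteq> O_space l"
  unfolding O_space_def using holomorphic_on_subset half_plane_mono by blast

lemma Union_O_space: "(\<Union>k. O_space k) = UNIV"
proof -
  have "x \<in> (\<Union>k. O_space k)" for x
    by (rule germ_cases[of x]) (auto simp: O_space_def)
  then show ?thesis by blast
qed

lemma holomorphic_germ_eval:
  assumes "g \<in> O_space k"
  shows "germ_eval g holomorphic_on half_plane k"
proof -
  obtain f where f: "f holomorphic_on half_plane k" "g = germ f"
    using assms by (auto simp: O_space_def)
  show ?thesis
    by (rule holomorphic_transform[OF f(1)]) (simp add: f germ_eval_germ[OF f(1)])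
qed

lemma germ_germ_eval: "germ (germ_eval g) = g"
proof -
  obtain f k where f: "f holomorphic_on half_plane k" "g = germ f" by (rule germ_cases)
  have hol: "germ_eval g holomorphic_on half_plane k"
    by (rule holomorphic_germ_eval) (use f in \<open>auto simp: O_space_def\<close>)
  have "germ_rel (germ_eval g) f"
    by (rule germ_relI[OF hol f(1), of k]) (simp add: f germ_eval_germ[OF f(1)])
  then show ?thesis using germ_eq_iff[OF hol f(1)] f(2) by simp
qed

lemma O_space_const [simp]: "0 \<in> O_space k" "1 \<in> O_space k"
  by (auto simp: O_space_def zero_oinf_def one_oinf_def intro!: exI holomorphic_on_const)

lemma germ_eval_const [simp]: "germ_eval 0 z = 0" "germ_eval 1 z = 1"
  unfolding zero_oinf_def one_oinf_def
  by (subst germ_eval_germ[of _ "Re z - 1"]; simp add: half_plane_def)+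

lemma O_space_arith:
  assumes "f \<in> O_space k" "g \<in> O_space k"
  shows "f + g \<in> O_space k" "f - g \<in> O_space k" "f * g \<in> O_space k" "- f \<in> O_space k"
    and "z \<in> half_plane k \<Longrightarrow> germ_eval (f + g) z = germ_eval f z + germ_eval g z"
    and "z \<in> half_plane k \<Longrightarrow> germ_eval (f - g) z = germ_eval f z - germ_eval g z"
    and "z \<in> half_plane k \<Longrightarrow> germ_eval (f * g) z = germ_eval f z * germ_eval g z"
    and "z \<in> half_plane k \<Longrightarrow> germ_eval (- f) z = - germ_eval f z"
proof -
  obtain f' g' where *: "f' holomorphic_on half_plane k" "f = germ f'"
      "g' holomorphic_on half_plane k" "g = germ g'"
    using assms by (auto simp: O_space_def)
  note hol = holomorphic_on_add[OF *(1,3)] holomorphic_on_diff[OF *(1,3)]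
    holomorphic_on_mult[OF *(1,3)] holomorphic_on_minus[OF *(1)]
  note eq = plus_germ[OF *(1,3)] minus_germ[OF *(1,3)] times_germ[OF *(1,3)] uminus_germ[OF *(1)]
  show "f + g \<in> O_space k" "f - g \<in> O_space k" "f * g \<in> O_space k" "- f \<in> O_space k"
    using hol by (auto simp: *(2,4) eq O_space_def)
  assume z: "z \<in> half_plane k"
  show "germ_eval (f + g) z = germ_eval f z + germ_eval g z"
    "germ_eval (f - g) z = germ_eval f z - germ_eval g z"
    "germ_eval (f * g) z = germ_eval f z * germ_eval g z"
    "germ_eval (- f) z = - germ_eval f z"
    using z by (simp_all add: *(2,4) eq germ_eval_germ[OF hol(1)] germ_eval_germ[OF hol(2)]
        germ_eval_germ[OF hol(3)] germ_eval_germ[OF hol(4)] germ_eval_germ[OF *(1)] germ_eval_germ[OF *(3)])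
qed

lemma O_space_sum:
  assumes "\<And>i. i \<in> A \<Longrightarrow> f i \<in> O_space k"
  shows "sum f A \<in> O_space k"
    and "z \<in> half_plane k \<Longrightarrow> germ_eval (sum f A) z = (\<Sum>i\<in>A. germ_eval (f i) z)"
proof -
  have "sum f A \<in> O_space k \<and>
    (z \<in> half_plane k \<longrightarrow> germ_eval (sum f A) z = (\<Sum>i\<in>A. germ_eval (f i) z))" for z
    using assms
    by (induction A rule: infinite_finite_induct) (auto simp: O_space_arith(1) O_space_arith(5)[where k = k])
  then show "sum f A \<in> O_space k"
    and "z \<in> half_plane k \<Longrightarrow> germ_eval (sum f A) z = (\<Sum>i\<in>A. germ_eval (f i) z)"
    by auto
qed

text \<open>Functions on the positive integers, represented as functions on \<open>nat\<close> normalised at \<open>0\<close>.\<close>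

typedef (overloaded) 'a arith_fun = "{f :: nat \<Rightarrow> 'a :: zero. f 0 = 0}"
  morphisms af_nth Abs_arith_fun
  by (rule exI[of _ "\<lambda>_. 0"]) simp

setup_lifting type_definition_arith_fun

lemma af_nth_0 [simp]: "af_nth \<alpha> 0 = 0"
  using af_nth[of \<alpha>] by simp

lemma arith_fun_eqI: "(\<And>n. n \<ge> 1 \<Longrightarrow> af_nth \<alpha> n = af_nth \<beta> n) \<Longrightarrow> \<alpha> = \<beta>"
  by transfer (metis One_nat_def Suc_leI ext neq0_conv)

lemma finite_factor_pairs: "n > 0 \<Longrightarrow> finite {(a, b). a * b = (n::nat)}"
  by (rule finite_subset[of _ "{..n} \<times> {..n}"]) auto

instantiation arith_fun :: (comm_ring_1) comm_ring_1
begin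

lift_definition zero_arith_fun :: "'a arith_fun" is "\<lambda>_. 0" by simp
lift_definition one_arith_fun :: "'a arith_fun" is "\<lambda>n. if n = 1 then 1 else 0" by simp
lift_definition plus_arith_fun :: "'a arith_fun \<Rightarrow> 'a arith_fun \<Rightarrow> 'a arith_fun"
  is "\<lambda>f g n. f n + g n" by simp
lift_definition minus_arith_fun :: "'a arith_fun \<Rightarrow> 'a arith_fun \<Rightarrow> 'a arith_fun"
  is "\<lambda>f g n. f n - g n" by simp
lift_definition uminus_arith_fun :: "'a arith_fun \<Rightarrow> 'a arith_fun"
  is "\<lambda>f n. - f n" by simp
lift_definition times_arith_fun :: "'a arith_fun \<Rightarrow> 'a arith_fun \<Rightarrow> 'a arith_fun"
  is "\<lambda>f g n. if n = 0 then 0 else \<Sum>(a, b) | a * b = n. f a * g b" by simp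

lemma af_nth_times:
  "n > 0 \<Longrightarrow> af_nth (\<alpha> * \<beta>) n = (\<Sum>(a, b) | a * b = n. af_nth \<alpha> a * af_nth \<beta> b)"
  by transfer simp

instance
proof
  fix f g h :: "'a arith_fun"
  show "f * g = g * f"
  proof (rule arith_fun_eqI)
    fix n :: nat assume n: "n \<ge> 1"
    show "af_nth (f * g) n = af_nth (g * f) n"
      using n by (simp add: af_nth_times)
        (rule sum.reindex_bij_witness[of _ prod.swap prod.swap]; auto simp: mult.commute)
  qed
  show "1 * f = f"
  proof (rule arith_fun_eqI)
    fix n :: nat assume n: "n \<ge> 1"
    have "af_nth (1 * f) n = (\<Sum>(a, b) | a * b = n. if a = 1 then af_nth f b else 0)"
      using n by (simp add: af_nth_times one_arith_fun.rep_eq)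
        (intro sum.cong; auto)
    also have "\<dots> = (\<Sum>(a, b) \<in> {(1::nat, n)}. if a = 1 then af_nth f b else 0)"
      by (rule sum.mono_neutral_right) (use n finite_factor_pairs in \<open>auto split: if_splits\<close>)
    finally show "af_nth (1 * f) n = af_nth f n" by simp
  qed
  show "(f + g) * h = f * h + g * h"
  proof (rule arith_fun_eqI)
    fix n :: nat assume n: "n \<ge> 1"
    show "af_nth ((f + g) * h) n = af_nth (f * h + g * h) n"
      using n by (simp add: af_nth_times plus_arith_fun.rep_eq case_prod_unfold distrib_right sum.distrib)
  qed
  show "f * g * h = f * (g * h)"
  proof (rule arith_fun_eqI)
    fix n :: nat assume n: "n \<ge> 1"
    have pos: "a > 0" "b > 0" if "a * b = n" for a b using that n by (auto intro: ccontr)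
    have "af_nth (f * g * h) n =
      (\<Sum>p | fst p * snd p = n. \<Sum>q | fst q * snd q = fst p.
         af_nth f (fst q) * af_nth g (snd q) * af_nth h (snd p))"
      using n by (simp add: af_nth_times case_prod_unfold)
        (intro sum.cong refl; simp add: af_nth_times pos case_prod_unfold sum_distrib_right)
    also have "\<dots> = (\<Sum>(p, q) \<in> (SIGMA p:{p. fst p * snd p = n}. {q. fst q * snd q = fst p}).
         af_nth f (fst q) * af_nth g (snd q) * af_nth h (snd p))"
      by (rule sum.Sigma) (use finite_factor_pairs n pos in \<open>auto simp: case_prod_unfold\<close>)
    also have "\<dots> = (\<Sum>(p, q) \<in> (SIGMA p:{p. fst p * snd p = n}. {q. fst q * snd q = snd p}).
         af_nth f (fst p) * (af_nth g (fst q) * af_nth h (snd q)))"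
      by (rule sum.reindex_bij_witness[of _ "\<lambda>(p, q). ((fst p * fst q, snd q), (fst p, fst q))"
            "\<lambda>(p, q). ((fst q, snd q * snd p), (snd q, snd p))"])
        (auto simp: algebra_simps)
    also have "\<dots> = (\<Sum>p | fst p * snd p = n. \<Sum>q | fst q * snd q = snd p.
         af_nth f (fst p) * (af_nth g (fst q) * af_nth h (snd q)))"
      by (rule sum.Sigma[symmetric]) (use finite_factor_pairs n pos in \<open>auto simp: case_prod_unfold\<close>)
    also have "\<dots> = af_nth (f * (g * h)) n"
      using n by (simp add: af_nth_times case_prod_unfold)
        (intro sum.cong refl; simp add: af_nth_times pos case_prod_unfold sum_distrib_left)
    finally show "af_nth (f * g * h) n = af_nth (f * (g * h)) n" .
  qed
  show "(0::'a arith_fun) \<noteq> 1" by transfer (auto simp: fun_eq_iff)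
qed (transfer; simp add: algebra_simps)+

end

lift_definition af_scale :: "'a :: comm_ring_1 \<Rightarrow> 'a arith_fun \<Rightarrow> 'a arith_fun"
  is "\<lambda>c f n. c * f n" by simp

lemma module_af_scale: "module (af_scale :: 'a :: comm_ring_1 \<Rightarrow> _)"
  by unfold_locales (transfer; simp add: algebra_simps)+

lemma af_scale_times: "af_scale c (\<alpha> * \<beta>) = af_scale c \<alpha> * \<beta>"
  by (rule arith_fun_eqI)
    (simp add: af_scale.rep_eq af_nth_times sum_distrib_left case_prod_unfold mult.assoc)

definition C_space :: "real \<Rightarrow> oinf arith_fun set" where
  "C_space k = {\<alpha>. (\<forall>n\<ge>1. af_nth \<alpha> n \<in> O_space k) \<and>
     (\<forall>\<epsilon>>0. \<exists>M :: complex \<Rightarrow> real. continuous_on (half_plane k) M \<and> (\<forall>z\<in>half_plane k. M z \<ge> 0) \<and>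
        (\<forall>n\<ge>1. \<forall>z\<in>half_plane k.
           norm (germ_eval (af_nth \<alpha> n) z) < real n powr (k + \<epsilon>) * M z))}"

definition E_space :: "real \<Rightarrow> oinf arith_fun set" where
  "E_space k = {L. (\<forall>n\<ge>1. af_nth L n \<in> O_space k) \<and>
     (\<exists>c>0. \<exists>C :: complex \<Rightarrow> real. continuous_on (half_plane k) C \<and> (\<forall>z\<in>half_plane k. C z \<ge> 0) \<and>
        (\<forall>n\<ge>1. \<forall>z\<in>half_plane k.
           norm (germ_eval (af_nth L n) z) \<le> C z * real n powr (- c * Re z)))}"

definition C_infty :: "oinf arith_fun set" where
  "C_infty = (\<Union>k. C_space k)"

definition E_infty :: "oinf arith_fun set" where
  "E_infty = (\<Union>k. E_space k)"

lemma C_space_O: "\<alpha> \<in> C_space k \<Longrightarrow> af_nth \<alpha> n \<in> O_space k"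
  by (cases "n = 0") (auto simp: C_space_def)

lemma E_space_O: "L \<in> E_space k \<Longrightarrow> af_nth L n \<in> O_space k"
  by (cases "n = 0") (auto simp: E_space_def)

lemma C_spaceE:
  assumes "\<alpha> \<in> C_space k" "\<epsilon> > 0"
  obtains M :: "complex \<Rightarrow> real" where "continuous_on (half_plane k) M"
    "\<And>z. z \<in> half_plane k \<Longrightarrow> M z \<ge> 0"
    "\<And>n z. n \<ge> 1 \<Longrightarrow> z \<in> half_plane k \<Longrightarrow>
       norm (germ_eval (af_nth \<alpha> n) z) < real n powr (k + \<epsilon>) * M z"
proof -
  have "\<exists>M :: complex \<Rightarrow> real. continuous_on (half_plane k) M \<and> (\<forall>z\<in>half_plane k. M z \<ge> 0) \<and>
        (\<forall>n\<ge>1. \<forall>z\<in>half_plane k.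
           norm (germ_eval (af_nth \<alpha> n) z) < real n powr (k + \<epsilon>) * M z)"
    using assms unfolding C_space_def by blast
  then show ?thesis using that by blast
qed

lemma C_spaceI:
  assumes "\<And>n. n \<ge> 1 \<Longrightarrow> af_nth \<alpha> n \<in> O_space k"
    and "\<And>\<epsilon>. \<epsilon> > 0 \<Longrightarrow> \<exists>M :: complex \<Rightarrow> real. continuous_on (half_plane k) M \<and>
       (\<forall>z\<in>half_plane k. M z \<ge> 0) \<and>
       (\<forall>n z. n \<ge> 1 \<longrightarrow> z \<in> half_plane k \<longrightarrow>
          norm (germ_eval (af_nth \<alpha> n) z) \<le> real n powr (k + \<epsilon>) * M z)"
  shows "\<alpha> \<in> C_space k"
  unfolding C_space_def
proof (intro CollectI conjI allI impI)
  fix \<epsilon> :: real assume "\<epsilon> > 0"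
  from assms(2)[OF this] obtain M :: "complex \<Rightarrow> real" where M: "continuous_on (half_plane k) M"
    "\<And>z. z \<in> half_plane k \<Longrightarrow> M z \<ge> 0"
    "\<And>n z. n \<ge> 1 \<Longrightarrow> z \<in> half_plane k \<Longrightarrow>
       norm (germ_eval (af_nth \<alpha> n) z) \<le> real n powr (k + \<epsilon>) * M z" by blast
  show "\<exists>M :: complex \<Rightarrow> real. continuous_on (half_plane k) M \<and> (\<forall>z\<in>half_plane k. M z \<ge> 0) \<and>
        (\<forall>n\<ge>1. \<forall>z\<in>half_plane k.
           norm (germ_eval (af_nth \<alpha> n) z) < real n powr (k + \<epsilon>) * M z)"
  proof (intro exI conjI allI impI ballI)
    show "continuous_on (half_plane k) (\<lambda>z. M z + 1)" by (intro continuous_intros M)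
    show "M z + 1 \<ge> 0" if "z \<in> half_plane k" for z using M(2)[OF that] by simp
    show "norm (germ_eval (af_nth \<alpha> n) z) < real n powr (k + \<epsilon>) * (M z + 1)"
      if "n \<ge> 1" "z \<in> half_plane k" for n z
    proof -
      have "real n powr (k + \<epsilon>) > 0" using that by simp
      moreover have "real n powr (k + \<epsilon>) * (M z + 1) = real n powr (k + \<epsilon>) * M z + real n powr (k + \<epsilon>)"
        by (simp add: distrib_left)
      ultimately show ?thesis using M(3)[OF that] by linarith
    qed
  qed
qed (use assms(1) in auto)

lemma C_space_mono:
  assumes "k \<le> l"
  shows "C_space k \<subseteq> C_space l"
proof
  fix \<alpha> assume a: "\<alpha> \<in> C_space k"
  note sub = half_plane_mono[OF assms]
  show "\<alpha> \<in> C_space l"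
  proof (rule C_spaceI)
    show "af_nth \<alpha> n \<in> O_space l" for n
      using C_space_O[OF a] O_space_mono[OF assms] by blast
    fix \<epsilon> :: real assume "\<epsilon> > 0"
    obtain M :: "complex \<Rightarrow> real" where M: "continuous_on (half_plane k) M"
      "\<And>z. z \<in> half_plane k \<Longrightarrow> M z \<ge> 0"
      "\<And>n z. n \<ge> 1 \<Longrightarrow> z \<in> half_plane k \<Longrightarrow>
         norm (germ_eval (af_nth \<alpha> n) z) < real n powr (k + \<epsilon>) * M z"
      using C_spaceE[OF a \<open>\<epsilon> > 0\<close>] by blast
    have "norm (germ_eval (af_nth \<alpha> n) z) \<le> real n powr (l + \<epsilon>) * M z"
      if "n \<ge> 1" "z \<in> half_plane l" for n z
    proof -
      have "real n powr (k + \<epsilon>) * M z \<le> real n powr (l + \<epsilon>) * M z"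
        using that M(2)[of z] sub assms by (intro mult_right_mono powr_mono) auto
      then show ?thesis using M(3)[of n z] that sub by force
    qed
    then show "\<exists>M :: complex \<Rightarrow> real. continuous_on (half_plane l) M \<and>
       (\<forall>z\<in>half_plane l. M z \<ge> 0) \<and> (\<forall>n z. n \<ge> 1 \<longrightarrow> z \<in> half_plane l \<longrightarrow>
          norm (germ_eval (af_nth \<alpha> n) z) \<le> real n powr (l + \<epsilon>) * M z)"
      using M(2) continuous_on_subset[OF M(1) sub] sub by blast
  qed
qed

lemma E_space_mono:
  assumes "k \<le> l"
  shows "E_space k \<subseteq> E_space l"
proof
  fix L assume L: "L \<in> E_space k"
  note sub = half_plane_mono[OF assms]
  have "af_nth L n \<in> O_space l" for n
    using E_space_O[OF L] O_space_mono[OF assms] by blast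
  moreover from L obtain c C where "c > 0" "continuous_on (half_plane k) C"
    "\<forall>z\<in>half_plane k. C z \<ge> 0" "\<forall>n\<ge>1. \<forall>z\<in>half_plane k.
           norm (germ_eval (af_nth L n) z) \<le> C z * real n powr (- c * Re z)"
    unfolding E_space_def by blast
  ultimately show "L \<in> E_space l"
    unfolding E_space_def using continuous_on_subset[OF _ sub] sub by (blast intro: exI[of _ c])
qed

lemma C_infty_common:
  assumes "\<alpha> \<in> C_infty" "\<beta> \<in> C_infty"
  obtains k where "\<alpha> \<in> C_space k" "\<beta> \<in> C_space k"
proof -
  obtain k l where "\<alpha> \<in> C_space k" "\<beta> \<in> C_space l" using assms by (auto simp: C_infty_def)
  then show ?thesis
    using that[of "max k l"] C_space_mono[of k "max k l"] C_space_mono[of l "max k l"] by auto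
qed

lemma C_infty_zero: "0 \<in> C_infty"
proof -
  have "0 \<in> C_space 0"
    by (rule C_spaceI) (auto simp: zero_arith_fun.rep_eq intro!: exI[of _ "\<lambda>_. 1"])
  then show ?thesis by (auto simp: C_infty_def)
qed

lemma C_infty_one: "1 \<in> C_infty"
proof -
  have "1 \<in> C_space 0"
    by (rule C_spaceI) (auto simp: one_arith_fun.rep_eq intro!: exI[of _ "\<lambda>_. 1"])
  then show ?thesis by (auto simp: C_infty_def)
qed

lemma C_infty_plus:
  assumes "\<alpha> \<in> C_infty" "\<beta> \<in> C_infty"
  shows "\<alpha> + \<beta> \<in> C_infty"
proof -
  obtain k where k: "\<alpha> \<in> C_space k" "\<beta> \<in> C_space k" using C_infty_common[OF assms] .
  have "\<alpha> + \<beta> \<in> C_space k"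
  proof (rule C_spaceI)
    show "af_nth (\<alpha> + \<beta>) n \<in> O_space k" for n
      using k by (simp add: plus_arith_fun.rep_eq C_space_O O_space_arith)
    fix \<epsilon> :: real assume e: "\<epsilon> > 0"
    obtain M :: "complex \<Rightarrow> real" where M: "continuous_on (half_plane k) M"
      "\<And>z. z \<in> half_plane k \<Longrightarrow> M z \<ge> 0"
      "\<And>n z. n \<ge> 1 \<Longrightarrow> z \<in> half_plane k \<Longrightarrow>
         norm (germ_eval (af_nth \<alpha> n) z) < real n powr (k + \<epsilon>) * M z"
      using C_spaceE[OF k(1) e] by blast
    obtain N :: "complex \<Rightarrow> real" where N: "continuous_on (half_plane k) N"
      "\<And>z. z \<in> half_plane k \<Longrightarrow> N z \<ge> 0"
      "\<And>n z. n \<ge> 1 \<Longrightarrow> z \<in> half_plane k \<Longrightarrow>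
         norm (germ_eval (af_nth \<beta> n) z) < real n powr (k + \<epsilon>) * N z"
      using C_spaceE[OF k(2) e] by blast
    show "\<exists>M :: complex \<Rightarrow> real. continuous_on (half_plane k) M \<and>
       (\<forall>z\<in>half_plane k. M z \<ge> 0) \<and> (\<forall>n z. n \<ge> 1 \<longrightarrow> z \<in> half_plane k \<longrightarrow>
          norm (germ_eval (af_nth (\<alpha> + \<beta>) n) z) \<le> real n powr (k + \<epsilon>) * M z)"
    proof (intro exI conjI allI impI ballI)
      show "continuous_on (half_plane k) (\<lambda>z. M z + N z)" by (intro continuous_intros M N)
      show "M z + N z \<ge> 0" if "z \<in> half_plane k" for z using M(2) N(2) that by simp
      fix n :: nat and z assume nz: "n \<ge> 1" "z \<in> half_plane k"
      have "germ_eval (af_nth (\<alpha> + \<beta>) n) z = germ_eval (af_nth \<alpha> n) z + germ_eval (af_nth \<beta> n) z"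
        using O_space_arith(5)[OF C_space_O[OF k(1)] C_space_O[OF k(2)] nz(2)]
        by (simp add: plus_arith_fun.rep_eq)
      then show "norm (germ_eval (af_nth (\<alpha> + \<beta>) n) z) \<le> real n powr (k + \<epsilon>) * (M z + N z)"
        using M(3)[OF nz] N(3)[OF nz] norm_triangle_ineq[of "germ_eval (af_nth \<alpha> n) z" "germ_eval (af_nth \<beta> n) z"]
        by (simp add: distrib_left)
    qed
  qed
  then show ?thesis by (auto simp: C_infty_def)
qed

lemma C_infty_scale:
  assumes "\<alpha> \<in> C_infty"
  shows "af_scale f \<alpha> \<in> C_infty"
proof -
  obtain k l where "\<alpha> \<in> C_space k" "f \<in> O_space l"
    using assms Union_O_space unfolding C_infty_def by (metis UNIV_I UN_E)
  then obtain k where k: "\<alpha> \<in> C_space k" "f \<in> O_space k"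
    using C_space_mono[of k "max k l"] O_space_mono[of l "max k l"]
    by (meson max.cobounded1 max.cobounded2 subsetD)
  have "af_scale f \<alpha> \<in> C_space k"
  proof (rule C_spaceI)
    show "af_nth (af_scale f \<alpha>) n \<in> O_space k" for n
      using k by (simp add: af_scale.rep_eq C_space_O O_space_arith)
    fix \<epsilon> :: real assume e: "\<epsilon> > 0"
    obtain M :: "complex \<Rightarrow> real" where M: "continuous_on (half_plane k) M"
      "\<And>z. z \<in> half_plane k \<Longrightarrow> M z \<ge> 0"
      "\<And>n z. n \<ge> 1 \<Longrightarrow> z \<in> half_plane k \<Longrightarrow>
         norm (germ_eval (af_nth \<alpha> n) z) < real n powr (k + \<epsilon>) * M z"
      using C_spaceE[OF k(1) e] by blast
    show "\<exists>M :: complex \<Rightarrow> real. continuous_on (half_plane k) M \<and>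
       (\<forall>z\<in>half_plane k. M z \<ge> 0) \<and> (\<forall>n z. n \<ge> 1 \<longrightarrow> z \<in> half_plane k \<longrightarrow>
          norm (germ_eval (af_nth (af_scale f \<alpha>) n) z) \<le> real n powr (k + \<epsilon>) * M z)"
    proof (intro exI conjI allI impI ballI)
      show "continuous_on (half_plane k) (\<lambda>z. norm (germ_eval f z) * M z)"
        by (intro continuous_intros M holomorphic_on_imp_continuous_on holomorphic_germ_eval k)
      show "norm (germ_eval f z) * M z \<ge> 0" if "z \<in> half_plane k" for z using M(2) that by simp
      fix n :: nat and z assume nz: "n \<ge> 1" "z \<in> half_plane k"
      have "germ_eval (af_nth (af_scale f \<alpha>) n) z = germ_eval f z * germ_eval (af_nth \<alpha> n) z"
        using O_space_arith(7)[OF k(2) C_space_O[OF k(1)] nz(2)]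
        by (simp add: af_scale.rep_eq)
      then show "norm (germ_eval (af_nth (af_scale f \<alpha>) n) z)
                   \<le> real n powr (k + \<epsilon>) * (norm (germ_eval f z) * M z)"
        using mult_left_mono[OF less_imp_le[OF M(3)[OF nz]], of "norm (germ_eval f z)"]
        by (simp add: norm_mult mult_ac)
    qed
  qed
  then show ?thesis by (auto simp: C_infty_def)
qed

lemma C_infty_uminus:
  assumes "\<alpha> \<in> C_infty"
  shows "- \<alpha> \<in> C_infty"
proof -
  have "- \<alpha> = af_scale (- 1) \<alpha>" by transfer simp
  then show ?thesis using C_infty_scale[OF assms] by metis
qed

lemma C_infty_minus:
  assumes "\<alpha> \<in> C_infty" "\<beta> \<in> C_infty"
  shows "\<alpha> - \<beta> \<in> C_infty"
  using C_infty_plus[OF assms(1) C_infty_uminus[OF assms(2)]] by simp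

lemma card_factor_pairs:
  assumes "n > 0"
  shows "card {(a, b). a * b = (n::nat)} \<le> n"
proof -
  have "card {(a, b). a * b = n} \<le> card {1..n}"
  proof (rule card_inj_on_le)
    show "inj_on fst {(a, b). a * b = n}" using assms by (auto simp: inj_on_def)
    show "fst ` {(a, b). a * b = n} \<subseteq> {1..n}" using assms by (auto simp: Suc_le_eq intro: ccontr)
  qed simp
  then show ?thesis by simp
qed

lemma C_infty_times:
  assumes "\<alpha> \<in> C_infty" "\<beta> \<in> C_infty"
  shows "\<alpha> * \<beta> \<in> C_infty"
proof -
  obtain k where k: "\<alpha> \<in> C_space k" "\<beta> \<in> C_space k" using C_infty_common[OF assms] .
  have O: "af_nth \<alpha> a * af_nth \<beta> b \<in> O_space k" for a b
    using k by (simp add: C_space_O O_space_arith)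
  have sub: "half_plane (k + 1) \<subseteq> half_plane k" by (rule half_plane_mono) simp
  have "\<alpha> * \<beta> \<in> C_space (k + 1)"
  proof (rule C_spaceI)
    show "af_nth (\<alpha> * \<beta>) n \<in> O_space (k + 1)" if "n \<ge> 1" for n
    proof -
      have "af_nth (\<alpha> * \<beta>) n \<in> O_space k"
        using that by (simp add: af_nth_times) (rule O_space_sum, use O in auto)
      then show ?thesis using O_space_mono[of k "k + 1"] by auto
    qed
    fix \<epsilon> :: real assume e: "\<epsilon> > 0"
    obtain M :: "complex \<Rightarrow> real" where M: "continuous_on (half_plane k) M"
      "\<And>z. z \<in> half_plane k \<Longrightarrow> M z \<ge> 0"
      "\<And>n z. n \<ge> 1 \<Longrightarrow> z \<in> half_plane k \<Longrightarrow>
         norm (germ_eval (af_nth \<alpha> n) z) < real n powr (k + \<epsilon>) * M z"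
      using C_spaceE[OF k(1) e] by blast
    obtain N :: "complex \<Rightarrow> real" where N: "continuous_on (half_plane k) N"
      "\<And>z. z \<in> half_plane k \<Longrightarrow> N z \<ge> 0"
      "\<And>n z. n \<ge> 1 \<Longrightarrow> z \<in> half_plane k \<Longrightarrow>
         norm (germ_eval (af_nth \<beta> n) z) < real n powr (k + \<epsilon>) * N z"
      using C_spaceE[OF k(2) e] by blast
    show "\<exists>M :: complex \<Rightarrow> real. continuous_on (half_plane (k + 1)) M \<and>
       (\<forall>z\<in>half_plane (k + 1). M z \<ge> 0) \<and> (\<forall>n z. n \<ge> 1 \<longrightarrow> z \<in> half_plane (k + 1) \<longrightarrow>
          norm (germ_eval (af_nth (\<alpha> * \<beta>) n) z) \<le> real n powr (k + 1 + \<epsilon>) * M z)"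
    proof (intro exI conjI allI impI ballI)
      show "continuous_on (half_plane (k + 1)) (\<lambda>z. M z * N z)"
        by (intro continuous_intros continuous_on_subset[OF M(1) sub] continuous_on_subset[OF N(1) sub])
      show "M z * N z \<ge> 0" if "z \<in> half_plane (k + 1)" for z using M(2) N(2) that sub by auto
      fix n :: nat and z assume n: "n \<ge> 1" and "z \<in> half_plane (k + 1)"
      then have z: "z \<in> half_plane k" using sub by blast
      have "germ_eval (af_nth (\<alpha> * \<beta>) n) z =
          (\<Sum>p | fst p * snd p = n. germ_eval (af_nth \<alpha> (fst p)) z * germ_eval (af_nth \<beta> (snd p)) z)"
        using n O by (simp add: af_nth_times case_prod_unfold O_space_sum(2)[OF _ z]
            O_space_arith(7)[OF C_space_O[OF k(1)] C_space_O[OF k(2)] z])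
      also have "norm \<dots> \<le> (\<Sum>p\<in>{(a, b). a * b = n}. real n powr (k + \<epsilon>) * (M z * N z))"
        unfolding case_prod_unfold
      proof (rule sum_norm_le)
        fix p :: "nat \<times> nat" assume "p \<in> {p. fst p * snd p = n}"
        then have p: "fst p * snd p = n" "fst p \<ge> 1" "snd p \<ge> 1"
          using n by (auto simp: Suc_le_eq intro: ccontr)
        have "norm (germ_eval (af_nth \<alpha> (fst p)) z * germ_eval (af_nth \<beta> (snd p)) z)
          \<le> (real (fst p) powr (k + \<epsilon>) * M z) * (real (snd p) powr (k + \<epsilon>) * N z)"
          unfolding norm_mult using M(2)[OF z]
          by (intro mult_mono less_imp_le[OF M(3)] less_imp_le[OF N(3)] p z) auto
        also have "\<dots> = real n powr (k + \<epsilon>) * (M z * N z)"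
          by (simp add: p(1)[symmetric] powr_mult)
        finally show "norm (germ_eval (af_nth \<alpha> (fst p)) z * germ_eval (af_nth \<beta> (snd p)) z)
          \<le> real n powr (k + \<epsilon>) * (M z * N z)" .
      qed
      also have "\<dots> \<le> real n * (real n powr (k + \<epsilon>) * (M z * N z))"
        using card_factor_pairs[of n] n M(2)[OF z] N(2)[OF z]
        by (simp del: mult_le_cancel_right add: mult_right_mono)
      also have "\<dots> = real n powr (k + 1 + \<epsilon>) * (M z * N z)"
        using n by (simp add: powr_add)
      finally show "norm (germ_eval (af_nth (\<alpha> * \<beta>) n) z) \<le> real n powr (k + 1 + \<epsilon>) * (M z * N z)" .
    qed
  qed
  then show ?thesis by (auto simp: C_infty_def)
qed

typedef cinf = C_infty
  morphisms cinf_fun Abs_cinf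
  using C_infty_zero by blast

setup_lifting type_definition_cinf

instantiation cinf :: comm_ring_1
begin

lift_definition zero_cinf :: cinf is 0 by (rule C_infty_zero)
lift_definition one_cinf :: cinf is 1 by (rule C_infty_one)
lift_definition plus_cinf :: "cinf \<Rightarrow> cinf \<Rightarrow> cinf" is "(+)" by (rule C_infty_plus)
lift_definition minus_cinf :: "cinf \<Rightarrow> cinf \<Rightarrow> cinf" is "(-)" by (rule C_infty_minus)
lift_definition uminus_cinf :: "cinf \<Rightarrow> cinf" is uminus by (rule C_infty_uminus)
lift_definition times_cinf :: "cinf \<Rightarrow> cinf \<Rightarrow> cinf" is "(*)" by (rule C_infty_times)

instance
  by standard (transfer; simp add: algebra_simps)+

end

lift_definition cinf_scale :: "oinf \<Rightarrow> cinf \<Rightarrow> cinf" is af_scale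
  by (rule C_infty_scale)

lemma module_cinf_scale: "module cinf_scale"
proof -
  interpret module "af_scale :: oinf \<Rightarrow> _" by (rule module_af_scale)
  show ?thesis by unfold_locales (transfer; simp add: algebra_simps)+
qed

lemma cinf_scale_times: "cinf_scale f (\<alpha> * \<beta>) = cinf_scale f \<alpha> * \<beta>"
  by transfer (rule af_scale_times)

definition F_series :: "oinf arith_fun \<Rightarrow> cinf \<Rightarrow> nat \<Rightarrow> complex \<Rightarrow> complex" where
  "F_series L \<alpha> n z = germ_eval (af_nth (cinf_fun \<alpha>) n) z * germ_eval (af_nth L n) z"

definition F_map :: "oinf arith_fun \<Rightarrow> cinf \<Rightarrow> oinf" where
  "F_map L \<alpha> = germ (\<lambda>z. \<Sum>n. F_series L \<alpha> (Suc n) z)"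

lemma F_series_converges:
  assumes "L \<in> E_infty"
  obtains K where
    "\<And>z. z \<in> half_plane K \<Longrightarrow> summable (\<lambda>n. norm (F_series L \<alpha> (Suc n) z))"
    "\<And>S. compact S \<Longrightarrow> S \<subseteq> half_plane K \<Longrightarrow>
       uniform_limit S (\<lambda>N z. \<Sum>n<N. F_series L \<alpha> (Suc n) z) (\<lambda>z. \<Sum>n. F_series L \<alpha> (Suc n) z)
         sequentially"
    "(\<lambda>z. \<Sum>n. F_series L \<alpha> (Suc n) z) holomorphic_on half_plane K"
proof -
  obtain k l where "L \<in> E_space k" "cinf_fun \<alpha> \<in> C_space l"
    using assms cinf_fun[of \<alpha>] by (auto simp: C_infty_def E_infty_def)
  then obtain k where k: "L \<in> E_space k" "cinf_fun \<alpha> \<in> C_space k"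
    using C_space_mono[of l "max k l"] E_space_mono[of k "max k l"]
    by (meson max.cobounded1 max.cobounded2 subsetD)
  obtain M :: "complex \<Rightarrow> real" where M: "continuous_on (half_plane k) M"
      "\<And>z. z \<in> half_plane k \<Longrightarrow> M z \<ge> 0"
      "\<And>n z. n \<ge> 1 \<Longrightarrow> z \<in> half_plane k \<Longrightarrow>
         norm (germ_eval (af_nth (cinf_fun \<alpha>) n) z) < real n powr (k + 1) * M z"
    using C_spaceE[OF k(2), of 1] by auto
  obtain c C where c: "c > 0" and C: "continuous_on (half_plane k) C"
    "\<forall>z\<in>half_plane k. C z \<ge> 0" "\<forall>n\<ge>1. \<forall>z\<in>half_plane k.
           norm (germ_eval (af_nth L n) z) \<le> C z * real n powr (- c * Re z)"
    using k(1) unfolding E_space_def by blast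
  define K where "K = max k ((k + 3) / c)"
  have sub: "half_plane K \<subseteq> half_plane k" unfolding K_def by (rule half_plane_mono) simp
  have bound: "norm (F_series L \<alpha> (Suc n) z) \<le> M z * C z * real (Suc n) powr - 2"
    if z: "z \<in> half_plane K" for n z
  proof -
    have z': "z \<in> half_plane k" using z sub by blast
    have "(k + 3) / c < Re z" using z by (simp add: half_plane_def K_def)
    then have "k + 3 < c * Re z" using c by (simp add: field_simps)
    then have le: "k + 1 - c * Re z \<le> - 2" by simp
    have "norm (F_series L \<alpha> (Suc n) z)
       \<le> (real (Suc n) powr (k + 1) * M z) * (C z * real (Suc n) powr (- c * Re z))"
      unfolding F_series_def norm_mult using M(2)[OF z'] z'
      by (intro mult_mono less_imp_le[OF M(3)] C(3)[rule_format]) auto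
    also have "\<dots> = M z * C z * real (Suc n) powr (k + 1 - c * Re z)"
      by (simp add: powr_add powr_diff powr_minus field_simps)
    also have "\<dots> \<le> M z * C z * real (Suc n) powr - 2"
      using M(2)[OF z'] C(2) z' le by (intro mult_left_mono powr_mono) auto
    finally show ?thesis .
  qed
  have "summable (\<lambda>n. real n powr - 2)" by (subst summable_real_powr_iff) simp
  then have s2: "summable (\<lambda>n. real (Suc n) powr - 2)" by (subst summable_Suc_iff)
  have 1: "summable (\<lambda>n. norm (F_series L \<alpha> (Suc n) z))" if "z \<in> half_plane K" for z
    by (rule summable_comparison_test'[OF summable_mult[OF s2, of "M z * C z"], of 0])
      (use bound[OF that] in simp)
  have 2: "uniform_limit S (\<lambda>N z. \<Sum>n<N. F_series L \<alpha> (Suc n) z)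
      (\<lambda>z. \<Sum>n. F_series L \<alpha> (Suc n) z) sequentially"
    if S: "compact S" "S \<subseteq> half_plane K" for S
  proof -
    have "continuous_on S (\<lambda>z. M z * C z)"
      using S(2) sub by (intro continuous_intros continuous_on_subset[OF M(1)] continuous_on_subset[OF C(1)]) auto
    then have "bounded ((\<lambda>z. M z * C z) ` S)"
      using S(1) compact_continuous_image compact_imp_bounded by blast
    then obtain B where B: "\<And>z. z \<in> S \<Longrightarrow> norm (M z * C z) \<le> B"
      unfolding bounded_iff by blast
    show ?thesis
    proof (rule Weierstrass_m_test)
      show "summable (\<lambda>n. B * real (Suc n) powr - 2)" by (intro summable_mult s2)
      fix n z assume z: "z \<in> S"
      have "M z * C z * real (Suc n) powr - 2 \<le> B * real (Suc n) powr - 2"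
        using B[OF z] by (intro mult_right_mono) auto
      then show "norm (F_series L \<alpha> (Suc n) z) \<le> B * real (Suc n) powr - 2"
        using order_trans[OF bound[OF subsetD[OF S(2) z]]] by blast
    qed
  qed
  have 3: "(\<lambda>z. \<Sum>n. F_series L \<alpha> (Suc n) z) holomorphic_on half_plane K"
  proof (rule holomorphic_uniform_sequence[OF open_half_plane])
    show "(\<lambda>z. \<Sum>n<N. F_series L \<alpha> (Suc n) z) holomorphic_on half_plane K" for N
      unfolding F_series_def
      by (intro holomorphic_intros holomorphic_on_subset[OF holomorphic_germ_eval sub]
          C_space_O[OF k(2)] E_space_O[OF k(1)])
    fix z assume "z \<in> half_plane K"
    then obtain d where d: "d > 0" "cball z d \<subseteq> half_plane K"
      using open_half_plane open_contains_cball by blast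
    show "\<exists>d>0. cball z d \<subseteq> half_plane K \<and> uniform_limit (cball z d)
       (\<lambda>N z. \<Sum>n<N. F_series L \<alpha> (Suc n) z) (\<lambda>z. \<Sum>n. F_series L \<alpha> (Suc n) z) sequentially"
      using d 2[OF compact_cball d(2)] by (intro exI[of _ d] conjI)
  qed
  show ?thesis by (rule that[OF 1 2 3])
qed

definition algebra_hom ::
  "('a :: comm_ring_1 \<Rightarrow> 'b :: comm_ring_1 \<Rightarrow> 'b) \<Rightarrow> ('a \<Rightarrow> 'c :: comm_ring_1 \<Rightarrow> 'c) \<Rightarrow> ('b \<Rightarrow> 'c) \<Rightarrow> bool"
where
  "algebra_hom s1 s2 f \<longleftrightarrow>
     module_hom s1 s2 f \<and> (\<forall>x y. f (x * y) = f x * f y) \<and> f 1 = 1"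

end

theory Submission
  imports Defs
begin

text \<open>
  An element of \<open>\<O>\<^sub>\<infinity>\<close> is determined by its values for \<open>Re z \<rightarrow> \<infinity>\<close>, so every identity between
  elements of \<open>\<O>\<^sub>\<infinity>\<close> is checked pointwise, eventually along the filter of right half-planes, where
  the series \<open>F\<^sub>L(\<alpha>)(z)\<close> converge absolutely. Surjectivity comes from \<open>F\<^sub>L(f e) = f L(1)\<close> and the
  invertibility of \<open>L(1)\<close>. In the multiplicative case the product of two absolutely convergent
  series is rearranged along the fibres of \<open>(a, b) \<mapsto> a b\<close>, and \<open>L(1)\<close> is an idempotent of
  \<open>\<O>\<^sub>\<infinity>\<close>, hence \<open>0\<close> or \<open>1\<close> because half-planes are connected; \<open>L(1) = 0\<close> would force \<open>L = 0\<close>.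
\<close>

section \<open>Germs as Re z tends to infinity\<close>

text \<open>The filter spares the bookkeeping of abscissae: \<open>eventually_elim\<close>
  intersects finitely many half-planes at once.\<close>

definition right_half_planes :: "complex filter" where
  "right_half_planes = filtercomap Re at_top"

lemma eventually_right_half_planes:
  "eventually P right_half_planes \<longleftrightarrow> (\<exists>k. \<forall>z\<in>half_plane k. P z)"
  by (simp add: right_half_planes_def eventually_filtercomap_at_top_dense half_plane_def Ball_def)

lemma eventually_right_half_planesI:
  "(\<And>z. z \<in> half_plane k \<Longrightarrow> P z) \<Longrightarrow> eventually P right_half_planes"
  by (auto simp: eventually_right_half_planes)

lemma oinf_in_O_space: obtains k where "f \<in> O_space k"
  using Union_O_space by blast

lemma oinf_common_O_space:
  obtains k where "f \<in> O_space k" "g \<in> O_space k"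
proof -
  obtain k l where "f \<in> O_space k" "g \<in> O_space l"
    using oinf_in_O_space by metis
  then show ?thesis
    using that[of "max k l"] O_space_mono[of k "max k l"] O_space_mono[of l "max k l"] by auto
qed

text \<open>Each germ is represented by its own \<open>germ_eval\<close>, so agreement on one
  half-plane is already an instance of \<open>germ_rel\<close>.\<close>

lemma oinf_eqI:
  assumes "\<forall>\<^sub>F z in right_half_planes. germ_eval f z = germ_eval g z"
  shows "f = g"
proof -
  obtain k where k: "f \<in> O_space k" "g \<in> O_space k" by (rule oinf_common_O_space)
  obtain m where m: "\<And>z. z \<in> half_plane m \<Longrightarrow> germ_eval f z = germ_eval g z"
    using assms by (auto simp: eventually_right_half_planes)
  note hol = holomorphic_germ_eval[OF k(1)] holomorphic_germ_eval[OF k(2)]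
  have "germ (germ_eval f) = germ (germ_eval g)"
    unfolding germ_eq_iff[OF hol] by (rule germ_relI[OF hol m])
  then show ?thesis by (simp add: germ_germ_eval)
qed

lemma eventually_germ_eval_add:
  "\<forall>\<^sub>F z in right_half_planes. germ_eval (f + g) z = germ_eval f z + germ_eval g z"
  using O_space_arith(5) oinf_common_O_space[of f g]
  unfolding eventually_right_half_planes by metis

lemma eventually_germ_eval_mult:
  "\<forall>\<^sub>F z in right_half_planes. germ_eval (f * g) z = germ_eval f z * germ_eval g z"
  using O_space_arith(7) oinf_common_O_space[of f g]
  unfolding eventually_right_half_planes by metis

text \<open>The inverse only has to exist further to the right: beyond \<open>max k m\<close> the
  function is both holomorphic and free of zeros.\<close>

lemma oinf_invertible:
  assumes "\<forall>\<^sub>F z in right_half_planes. germ_eval f z \<noteq> 0"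
  obtains g where "g * f = 1"
proof -
  obtain k where k: "f \<in> O_space k" by (rule oinf_in_O_space)
  obtain m where m: "\<And>z. z \<in> half_plane m \<Longrightarrow> germ_eval f z \<noteq> 0"
    using assms by (auto simp: eventually_right_half_planes)
  define N where "N = max k m"
  have sub: "half_plane N \<subseteq> half_plane k" "half_plane N \<subseteq> half_plane m"
    by (auto simp: N_def half_plane_def)
  have hol: "(\<lambda>z. inverse (germ_eval f z)) holomorphic_on half_plane N"
    using m sub by (intro holomorphic_intros holomorphic_on_subset[OF holomorphic_germ_eval[OF k]]) auto
  define g where "g = germ (\<lambda>z. inverse (germ_eval f z))"
  have "\<forall>\<^sub>F z in right_half_planes. germ_eval g z = inverse (germ_eval f z)"
    unfolding eventually_right_half_planes g_def using germ_eval_germ[OF hol] by blast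
  then have "\<forall>\<^sub>F z in right_half_planes. germ_eval (g * f) z = germ_eval 1 z"
    using assms eventually_germ_eval_mult[of g f] by eventually_elim simp
  then show ?thesis by (rule that[OF oinf_eqI])
qed

text \<open>Every value solves w^2 = w, and a continuous function with finite range on a connected
  set is constant.\<close>

lemma oinf_idempotent:
  fixes f :: oinf
  assumes "f * f = f"
  shows "f = 0 \<or> f = 1"
proof -
  obtain k where k: "f \<in> O_space k" by (rule oinf_in_O_space)
  have "germ_eval f z = 0 \<or> germ_eval f z = 1" if "z \<in> half_plane k" for z
    using O_space_arith(7)[OF k k that] assms by simp
  then have "germ_eval f ` half_plane k \<subseteq> {0, 1}" by blast
  then have fin: "finite (germ_eval f ` half_plane k)"
    by (rule finite_subset) simp
  have "germ_eval f constant_on half_plane k"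
    by (rule continuous_finite_range_constant[OF connected_half_plane _ fin])
      (intro holomorphic_on_imp_continuous_on holomorphic_germ_eval k)
  then obtain c where c: "\<And>z. z \<in> half_plane k \<Longrightarrow> germ_eval f z = c"
    by (auto simp: constant_on_def)
  have "c = 0 \<or> c = 1"
    using c \<open>germ_eval f ` half_plane k \<subseteq> {0, 1}\<close> half_plane_nonempty[of k] by auto
  then show ?thesis
    using c oinf_eqI[of f 0] oinf_eqI[of f 1] by (auto simp: eventually_right_half_planes)
qed

section \<open>Linearity of F_L over the germs\<close>

text \<open>Holomorphy of the sum on \<open>half_plane K\<close> is what makes
  \<open>germ_eval\<close> return the actual sum there.\<close>

lemma eventually_F_series_sums:
  assumes "L \<in> E_infty"
  shows "\<forall>\<^sub>F z in right_half_planes. summable (\<lambda>n. norm (F_series L \<alpha> (Suc n) z)) \<and>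
           (\<lambda>n. F_series L \<alpha> (Suc n) z) sums germ_eval (F_map L \<alpha>) z"
proof (rule F_series_converges[OF assms, of \<alpha>])
  fix K
  assume s: "\<And>z. z \<in> half_plane K \<Longrightarrow> summable (\<lambda>n. norm (F_series L \<alpha> (Suc n) z))"
    and hol: "(\<lambda>z. \<Sum>n. F_series L \<alpha> (Suc n) z) holomorphic_on half_plane K"
  show ?thesis
    unfolding F_map_def
    by (rule eventually_right_half_planesI[of K])
      (simp add: germ_eval_germ[OF hol] s summable_sums[OF summable_norm_cancel[OF s]])
qed

text \<open>Uniqueness of limits turns each algebraic law for F_L into a computation with the terms
  of the series.\<close>

lemma F_map_eqI:
  assumes "L \<in> E_infty"
    and "\<forall>\<^sub>F z in right_half_planes. (\<lambda>n. F_series L \<alpha> (Suc n) z) sums germ_eval f z"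
  shows "F_map L \<alpha> = f"
proof (rule oinf_eqI)
  show "\<forall>\<^sub>F z in right_half_planes. germ_eval (F_map L \<alpha>) z = germ_eval f z"
    using eventually_F_series_sums[OF assms(1), of \<alpha>] assms(2)
    by eventually_elim (blast intro: sums_unique2)
qed

lemma cinf_C_space: obtains k where "cinf_fun \<alpha> \<in> C_space k"
  using cinf_fun[of \<alpha>] by (auto simp: C_infty_def)

lemma F_map_add:
  assumes "L \<in> E_infty"
  shows "F_map L (\<alpha> + \<beta>) = F_map L \<alpha> + F_map L \<beta>"
proof (rule F_map_eqI[OF assms])
  obtain k where k: "cinf_fun \<alpha> \<in> C_space k" "cinf_fun \<beta> \<in> C_space k"
    using C_infty_common[OF cinf_fun cinf_fun] .
  \<comment> \<open>The quantifier over \<open>n\<close> stands inside: one abscissa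
    \<open>k\<close> serves all coefficients, as membership in \<open>C_space k\<close>
    guarantees.\<close>
  have "\<forall>\<^sub>F z in right_half_planes. \<forall>n. F_series L (\<alpha> + \<beta>) n z = F_series L \<alpha> n z + F_series L \<beta> n z"
    using O_space_arith(5)[OF C_space_O[OF k(1)] C_space_O[OF k(2)]]
    by (intro eventually_right_half_planesI[of k])
      (simp add: F_series_def plus_cinf.rep_eq plus_arith_fun.rep_eq distrib_right)
  then show "\<forall>\<^sub>F z in right_half_planes.
      (\<lambda>n. F_series L (\<alpha> + \<beta>) (Suc n) z) sums germ_eval (F_map L \<alpha> + F_map L \<beta>) z"
    using eventually_F_series_sums[OF assms, of \<alpha>] eventually_F_series_sums[OF assms, of \<beta>]
      eventually_germ_eval_add[of "F_map L \<alpha>" "F_map L \<beta>"]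
    by eventually_elim (simp add: sums_add)
qed

lemma F_map_scale:
  assumes "L \<in> E_infty"
  shows "F_map L (cinf_scale f \<alpha>) = f * F_map L \<alpha>"
proof (rule F_map_eqI[OF assms])
  obtain k where k: "cinf_fun \<alpha> \<in> C_space k" by (rule cinf_C_space)
  obtain l where l: "f \<in> O_space l" by (rule oinf_in_O_space)
  have O: "f \<in> O_space (max k l)" "af_nth (cinf_fun \<alpha>) n \<in> O_space (max k l)" for n
    using l C_space_O[OF k] O_space_mono[of k "max k l"] O_space_mono[of l "max k l"] by auto
  have "\<forall>\<^sub>F z in right_half_planes. \<forall>n. F_series L (cinf_scale f \<alpha>) n z = germ_eval f z * F_series L \<alpha> n z"
    using O_space_arith(7)[OF O]
    by (intro eventually_right_half_planesI[of "max k l"])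
      (simp add: F_series_def cinf_scale.rep_eq af_scale.rep_eq mult.assoc)
  then show "\<forall>\<^sub>F z in right_half_planes.
      (\<lambda>n. F_series L (cinf_scale f \<alpha>) (Suc n) z) sums germ_eval (f * F_map L \<alpha>) z"
    using eventually_F_series_sums[OF assms, of \<alpha>] eventually_germ_eval_mult[of f "F_map L \<alpha>"]
    by eventually_elim (simp add: sums_mult)
qed

lemma F_map_one:
  assumes "L \<in> E_infty"
  shows "F_map L 1 = af_nth L 1"
proof (rule F_map_eqI[OF assms], rule always_eventually, rule allI)
  fix z
  \<comment> \<open>The series is shifted, so index 0 carries the coefficient at 1. The constants 0
    and 1 evaluate correctly at every z, so no half-plane has to be chosen.\<close>
  have "F_series L 1 (Suc n) z = (if n = 0 then germ_eval (af_nth L 1) z else 0)" for n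
    by (simp add: F_series_def one_cinf.rep_eq one_arith_fun.rep_eq)
  then show "(\<lambda>n. F_series L 1 (Suc n) z) sums germ_eval (af_nth L 1) z"
    using sums_single[of 0 "\<lambda>_. germ_eval (af_nth L 1) z"] by simp
qed

section \<open>Dirichlet convolution and multiplicativity\<close>

text \<open>Absolute convergence gives an unconditional sum over pairs of positive integers. Summing
  by rows yields \<open>A * B\<close>, summing over the fibres of the product yields the
  convolution.\<close>

lemma Dirichlet_product_sums:
  fixes f g :: "nat \<Rightarrow> complex"
  assumes f: "summable (\<lambda>n. norm (f (Suc n)))" "(\<lambda>n. f (Suc n)) sums A"
    and g: "summable (\<lambda>n. norm (g (Suc n)))" "(\<lambda>n. g (Suc n)) sums B"
  shows "(\<lambda>n. \<Sum>(a, b) | a * b = Suc n. f a * g b) sums (A * B)"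
proof -
  \<comment> \<open>The positive integers; \<open>f\<close> and \<open>g\<close> are arbitrary at
    0.\<close>
  let ?P = "range Suc"
  have Suc: "bij_betw Suc UNIV ?P" by (simp add: bij_betw_def)
  have fs: "(f has_sum A) ?P" and gs: "(g has_sum B) ?P"
    using norm_summable_imp_has_sum[OF f] norm_summable_imp_has_sum[OF g]
    by (simp_all add: has_sum_reindex_bij_betw[OF Suc])
  have fa: "(\<lambda>n. norm (f n)) summable_on ?P" and ga: "(\<lambda>n. norm (g n)) summable_on ?P"
    using norm_summable_imp_summable_on[of "\<lambda>n. norm (f (Suc n))"] f(1)
      norm_summable_imp_summable_on[of "\<lambda>n. norm (g (Suc n))"] g(1)
    unfolding summable_on_reindex_bij_betw[OF Suc, of "\<lambda>n. norm (f n)", symmetric]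
      summable_on_reindex_bij_betw[OF Suc, of "\<lambda>n. norm (g n)", symmetric] by simp_all
  have "(\<lambda>p. norm (f (fst p) * g (snd p))) summable_on ?P \<times> ?P"
    unfolding Infinite_Sum.abs_summable_on_Sigma_iff
    using fa ga by (auto simp: norm_mult infsum_cmult_right' abs_mult infsum_nonneg intro!: summable_on_cmult_right summable_on_cmult_left)
  then have "(\<lambda>p. f (fst p) * g (snd p)) summable_on ?P \<times> ?P"
    by (rule abs_summable_summable)
  then obtain S where S: "((\<lambda>p. f (fst p) * g (snd p)) has_sum S) (?P \<times> ?P)"
    by (auto simp: summable_on_def)
  \<comment> \<open>Summing the rows first identifies \<open>S\<close>.\<close>
  have "((\<lambda>a. f a * B) has_sum S) ?P"
    by (rule has_sum_SigmaD[OF S]) (simp add: has_sum_cmult_right[OF gs])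
  moreover have "((\<lambda>a. f a * B) has_sum (A * B)) ?P"
    by (rule has_sum_cmult_left[OF fs])
  ultimately have "S = A * B" by (rule has_sum_unique)
  have pos: "a \<in> ?P" "b \<in> ?P" if "a * b = Suc n" for a b n
    using that by (cases a; cases b; simp)+
  \<comment> \<open>A pair is tagged with the index \<open>n = a * b - 1\<close> of its fibre;
    forgetting the tag is a bijection onto \<open>?P \<times> ?P\<close> by
    \<open>pos\<close>.\<close>
  have "((\<lambda>q. f (fst (snd q)) * g (snd (snd q))) has_sum (A * B))
        (SIGMA n:UNIV. {(a, b). a * b = Suc n})
      \<longleftrightarrow> ((\<lambda>p. f (fst p) * g (snd p)) has_sum S) (?P \<times> ?P)"
    by (rule has_sum_reindex_bij_witness[where i = "\<lambda>p. (fst p * snd p - 1, p)" and j = snd])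
      (use \<open>S = A * B\<close> in \<open>auto dest: pos\<close>)
  with S have "((\<lambda>q. f (fst (snd q)) * g (snd (snd q))) has_sum (A * B))
        (SIGMA n:UNIV. {(a, b). a * b = Suc n})" by simp
  then have "((\<lambda>n. \<Sum>(a, b) | a * b = Suc n. f a * g b) has_sum (A * B)) UNIV"
    by (rule has_sum_SigmaD) (simp add: case_prod_unfold finite_factor_pairs[unfolded case_prod_unfold])
  then show ?thesis by (rule has_sum_imp_sums)
qed

text \<open>Multiplicativity splits \<open>L(ab)\<close> across each factorisation, so the terms for
  \<open>\<alpha> * \<beta>\<close> are the Dirichlet convolution of the terms for the two
  factors.\<close>

lemma F_map_mult:
  assumes "L \<in> E_infty"
    and mult: "\<And>a b. a \<ge> 1 \<Longrightarrow> b \<ge> 1 \<Longrightarrow> af_nth L (a * b) = af_nth L a * af_nth L b"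
  shows "F_map L (\<alpha> * \<beta>) = F_map L \<alpha> * F_map L \<beta>"
proof (rule F_map_eqI[OF assms(1)])
  obtain k where k: "cinf_fun \<alpha> \<in> C_space k" "cinf_fun \<beta> \<in> C_space k"
    using C_infty_common[OF cinf_fun cinf_fun] .
  obtain l where l: "L \<in> E_space l" using assms(1) by (auto simp: E_infty_def)
  have "F_series L (\<alpha> * \<beta>) (Suc n) z = (\<Sum>(a, b) | a * b = Suc n. F_series L \<alpha> a z * F_series L \<beta> b z)"
    if "z \<in> half_plane (max k l)" for n z
  proof -
    \<comment> \<open>Products of the coefficients of \<open>\<alpha>\<close> and
      \<open>\<beta>\<close> evaluate pointwise on the first half-plane, products of values of
      \<open>L\<close> on the second.\<close>
    have z: "z \<in> half_plane k" "z \<in> half_plane l" using that by (auto simp: half_plane_def)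
    note ev = O_space_arith(7)[OF C_space_O[OF k(1)] C_space_O[OF k(2)] z(1)]
      O_space_arith(7)[OF E_space_O[OF l] E_space_O[OF l] z(2)]
    have "germ_eval (af_nth (cinf_fun (\<alpha> * \<beta>)) (Suc n)) z =
      (\<Sum>(a, b) | a * b = Suc n. germ_eval (af_nth (cinf_fun \<alpha>) a) z * germ_eval (af_nth (cinf_fun \<beta>) b) z)"
      using k by (simp add: times_cinf.rep_eq af_nth_times case_prod_unfold ev O_space_sum(2)[OF _ z(1)]
          O_space_arith(3) C_space_O)
    then have "F_series L (\<alpha> * \<beta>) (Suc n) z = (\<Sum>(a, b) | a * b = Suc n.
        germ_eval (af_nth (cinf_fun \<alpha>) a) z * germ_eval (af_nth (cinf_fun \<beta>) b) z
          * germ_eval (af_nth L (Suc n)) z)"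
      by (simp add: F_series_def sum_distrib_right case_prod_unfold)
    also have "\<dots> = (\<Sum>(a, b) | a * b = Suc n. F_series L \<alpha> a z * F_series L \<beta> b z)"
    proof (rule sum.cong[OF refl], clarify)
      fix a b assume ab: "a * b = Suc n"
      then have "a \<ge> 1" "b \<ge> 1" by (auto simp: Suc_le_eq intro: ccontr)
      then have "germ_eval (af_nth L (Suc n)) z = germ_eval (af_nth L a) z * germ_eval (af_nth L b) z"
        using mult[of a b] ab ev(2) by simp
      then show "germ_eval (af_nth (cinf_fun \<alpha>) a) z * germ_eval (af_nth (cinf_fun \<beta>) b) z
          * germ_eval (af_nth L (Suc n)) z = F_series L \<alpha> a z * F_series L \<beta> b z"
        by (simp add: F_series_def)
    qed
    finally show ?thesis .
  qed
  then have "\<forall>\<^sub>F z in right_half_planes. \<forall>n. F_series L (\<alpha> * \<beta>) (Suc n) z =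
      (\<Sum>(a, b) | a * b = Suc n. F_series L \<alpha> a z * F_series L \<beta> b z)"
    unfolding eventually_right_half_planes by blast
  then show "\<forall>\<^sub>F z in right_half_planes.
      (\<lambda>n. F_series L (\<alpha> * \<beta>) (Suc n) z) sums germ_eval (F_map L \<alpha> * F_map L \<beta>) z"
    using eventually_F_series_sums[OF assms(1), of \<alpha>] eventually_F_series_sums[OF assms(1), of \<beta>]
      eventually_germ_eval_mult[of "F_map L \<alpha>" "F_map L \<beta>"]
    by eventually_elim (simp add: Dirichlet_product_sums)
qed

text \<open>This makes F_L unital: a = b = 1 shows that L(1) is idempotent, and a = 1 with b = n
  rules out L(1) = 0.\<close>

lemma multiplicative_nth_one:
  fixes L :: "oinf arith_fun"
  assumes mult: "\<And>a b. a \<ge> 1 \<Longrightarrow> b \<ge> 1 \<Longrightarrow> af_nth L (a * b) = af_nth L a * af_nth L b"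
    and "L \<noteq> 0"
  shows "af_nth L 1 = 1"
proof -
  have "af_nth L 1 \<noteq> 0"
  proof
    assume "af_nth L 1 = 0"
    then have "af_nth L n = 0" if "n \<ge> 1" for n using mult[of 1 n] that by simp
    then have "L = 0" by (intro arith_fun_eqI) (simp add: zero_arith_fun.rep_eq)
    with \<open>L \<noteq> 0\<close> show False ..
  qed
  then show ?thesis using oinf_idempotent[of "af_nth L 1"] mult[of 1 1] by simp
qed

theorem theorem1p5:
  fixes L :: "oinf arith_fun"
  assumes "L \<in> E_infty"
  shows "(module_hom cinf_scale (*) (F_map L) \<and>
          ((\<exists>K. \<forall>z. Re z > K \<longrightarrow> germ_eval (af_nth L 1) z \<noteq> 0) \<longrightarrow> surj (F_map L))) \<and>
         ((\<forall>a\<ge>1. \<forall>b\<ge>1. af_nth L (a * b) = af_nth L a * af_nth L b) \<and> L \<noteq> 0 \<longrightarrow>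
            algebra_hom cinf_scale (*) (F_map L) \<and> surj (F_map L) \<and>
            (\<forall>f. F_map L (cinf_scale f 1) = f))"
proof (intro conjI impI; (elim conjE)?)
  have "module ((*) :: oinf \<Rightarrow> oinf \<Rightarrow> oinf)"
    by unfold_locales (simp_all add: algebra_simps)
  then show hom: "module_hom cinf_scale (*) (F_map L)"
    by (simp add: module_hom_iff module_cinf_scale F_map_add F_map_scale assms)
  \<comment> \<open>Both surjectivity claims rest on this formula, by solving
    \<open>f * af_nth L 1 = h\<close> for a given germ \<open>h\<close>.\<close>
  have F_e: "F_map L (cinf_scale f 1) = f * af_nth L 1" for f
    by (simp only: F_map_scale[OF assms] F_map_one[OF assms])
  show "surj (F_map L)" if "\<exists>K. \<forall>z. Re z > K \<longrightarrow> germ_eval (af_nth L 1) z \<noteq> 0"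
  proof -
    have "\<forall>\<^sub>F z in right_half_planes. germ_eval (af_nth L 1) z \<noteq> 0"
      using that by (simp add: eventually_right_half_planes half_plane_def)
    then obtain g where "g * af_nth L 1 = 1" by (rule oinf_invertible)
    \<comment> \<open>Dividing by L(1) gives an explicit preimage supported at 1.\<close>
    then have "F_map L (cinf_scale (f * g) 1) = f" for f
      unfolding F_e by (simp add: mult.assoc)
    then show ?thesis by (rule surjI)
  qed
  assume L: "\<forall>a\<ge>1. \<forall>b\<ge>1. af_nth L (a * b) = af_nth L a * af_nth L b" "L \<noteq> 0"
  have L1: "af_nth L 1 = 1"
    by (rule multiplicative_nth_one) (use L in auto)
  show "algebra_hom cinf_scale (*) (F_map L)"
    unfolding algebra_hom_def using hom L1 L(1) F_map_mult[OF assms] F_map_one[OF assms] by simp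
  show right_inverse: "\<forall>f. F_map L (cinf_scale f 1) = f"
    unfolding F_e L1 by simp
  then show "surj (F_map L)" by (intro surjI) blast
qed

end
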